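(* Let $D_1$ and $D_2$ be two digraphs on $n_1$ and $n_2$ vertices, and $m_1$ and $m_2$ arcs, respectively. Suppose that $D_1$ is $r$-out-regular. Then (1) $$f_{L(D_1\mathbin{\dot\vee} D_2)}(\lambda)=(-1)^{n_1}(\lambda-1)^{n_1(r-1)}\,f_{L(D_2)}(\lambda-n_1)\,f_{L(D_1)}\bigl(r-(\lambda-r-n_2)(\lambda-1)\bigr)\left[1-\frac{(\lambda-1)n_1n_2}{(\lambda-n_1)\bigl((\lambda-n_2-r)(\lambda-1)-r\bigr)}\right],$$ (2) $$f_{Q(D_1\mathbin{\dot\vee} D_2)}(\lambda)=(\lambda-1)^{n_1(r-1)}\,f_{Q(D_2)}(\lambda-n_1)\,f_{Q(D_1)}\bigl(r+(\lambda-r-n_2)(\lambda-1)\bigr)\left[1-\frac{(\lambda-1)n_1\,\chi_{Q(D_2)}(\lambda-n_1)}{(\lambda-r-n_2)(\lambda-1)-r}\right].$$ In particular, the $L$-spectrum of $D_1\mathbin{\dot\vee} D_2$ is completely determined by the $L$-spectra of $D_1$ and $D_2$, and the $Q$-spectrum of $D_1\mathbin{\dot\vee} D_2$ is completely determined by the $Q$-spectra of $D_1$ and $D_2$, and the $Q$-coronal of $D_2$.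
   Context: Digraphs are finite, have at least one vertex, and are simple (no loops, no multiple arcs), but both arcs $uv$ and $vu$ may be present. The adjacency matrix $A(D)=[a_{ij}]$ has $a_{ij}=1$ if $v_iv_j$ is an arc and $0$ otherwise; $D_{\mathrm{out}}(D)$ is the diagonal matrix of out-degrees; $L(D)=D_{\mathrm{out}}(D)-A(D)$ is the Laplacian matrix and $Q(D)=D_{\mathrm{out}}(D)+A(D)$ the signless Laplacian matrix. $D$ is $r$-out-regular if every vertex has out-degree $r$. For an $n\times n$ real matrix $M$, $f_M(\lambda)=\det(\lambda I_n-M)$ and the coronal is $\chi_M(\lambda)=\mathbf 1_n^T(\lambda I_n-M)^{-1}\mathbf 1_n\in\mathbb C(\lambda)$, where $\mathbf 1_n$ is the all-ones column vector. The $L$-spectrum (resp. $Q$-spectrum) of $D$ is the multiset of roots of $f_{L(D)}$ (resp. $f_{Q(D)}$); the $Q$-coronal of $D$ is $\chi_{Q(D)}$. Identities are in $\mathbb C(\lambda)$. "Completely determined by" certain data means that (for $D_1$ ranging over out-regular digraphs) equal data yield equal spectra. The subdivision digraph $\mathcal S(D)$ is obtained from $D$ by replacing each arc $uv$ by a directed path $u\to w\to v$ of length two through a new vertex $w$ (one new vertex per arc). The subdivision-vertex join $D_1\mathbin{\dot\vee} D_2$ is obtained from the disjoint union of $\mathcal S(D_1)$ and $D_2$ by adding both arcs $vw$ and $wv$ for every original vertex $v\in V(D_1)$ and every $w\in V(D_2)$. *)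

theory Defs
  imports
    "Graph_Theory.Digraph"
    "Jordan_Normal_Form.Char_Poly"
    "Jordan_Normal_Form.Gauss_Jordan_Elimination"
    "HOL-Computational_Algebra.Computational_Algebra"
begin

section \<open>Digraphs\<close>

text \<open>The locale \<^locale>\<open>digraph\<close> describes finite digraphs without loops and multiple arcs;
  it admits the null graph, which is excluded here.\<close>

definition nonempty_digraph :: "('a, 'b) pre_digraph \<Rightarrow> bool" where
  "nonempty_digraph D \<longleftrightarrow> digraph D \<and> verts D \<noteq> {}"

definition out_regular :: "nat \<Rightarrow> ('a, 'b) pre_digraph \<Rightarrow> bool" where
  "out_regular r D \<longleftrightarrow> (\<forall>v \<in> verts D. out_degree D v = r)"

text \<open>Since there are no multiple arcs, the arcs of the constructed digraphs are represented by
  the pairs of their end points. In the subdivision digraph, \<^term>\<open>Inl v\<close> is the original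
  vertex \<^term>\<open>v\<close> and \<^term>\<open>Inr e\<close> is the new vertex on the arc \<^term>\<open>e\<close>.\<close>

definition subdivision_digraph ::
  "('a, 'b) pre_digraph \<Rightarrow> ('a + 'b, ('a + 'b) \<times> ('a + 'b)) pre_digraph" where
  "subdivision_digraph D = \<lparr>
     verts = Inl ` verts D \<union> Inr ` arcs D,
     arcs = (\<lambda>e. (Inl (tail D e), Inr e)) ` arcs D \<union> (\<lambda>e. (Inr e, Inl (head D e))) ` arcs D,
     tail = fst,
     head = snd \<rparr>"

definition subdivision_vertex_join ::
  "('a, 'b) pre_digraph \<Rightarrow> ('c, 'd) pre_digraph \<Rightarrow>
   (('a + 'b) + 'c, (('a + 'b) + 'c) \<times> (('a + 'b) + 'c)) pre_digraph" (infixl "\<or>\<^sub>S" 65) where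
  "D1 \<or>\<^sub>S D2 = \<lparr>
     verts = Inl ` verts (subdivision_digraph D1) \<union> Inr ` verts D2,
     arcs = {(Inl x, Inl y) | x y. (x, y) \<in> arcs_ends (subdivision_digraph D1)}
          \<union> {(Inr x, Inr y) | x y. (x, y) \<in> arcs_ends D2}
          \<union> {(Inl (Inl v), Inr w) | v w. v \<in> verts D1 \<and> w \<in> verts D2}
          \<union> {(Inr w, Inl (Inl v)) | v w. v \<in> verts D1 \<and> w \<in> verts D2},
     tail = fst,
     head = snd \<rparr>"

lemma nonempty_digraph_subdivision:
  assumes "nonempty_digraph D"
  shows "nonempty_digraph (subdivision_digraph D)"
proof -
  interpret digraph D using assms by (simp add: nonempty_digraph_def)
  have "digraph (subdivision_digraph D)"
    by unfold_locales (auto simp: subdivision_digraph_def arc_to_ends_def)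
  thus ?thesis using assms by (auto simp: nonempty_digraph_def subdivision_digraph_def)
qed

lemma nonempty_digraph_join:
  assumes "nonempty_digraph D1" "nonempty_digraph D2"
  shows "nonempty_digraph (D1 \<or>\<^sub>S D2)"
proof -
  interpret D1: digraph D1 using assms by (simp add: nonempty_digraph_def)
  interpret D2: digraph D2 using assms by (simp add: nonempty_digraph_def)
  interpret S: digraph "subdivision_digraph D1"
    using nonempty_digraph_subdivision[OF assms(1)] by (simp add: nonempty_digraph_def)
  let ?J = "D1 \<or>\<^sub>S D2"
  have vf: "finite (verts ?J)" by (simp add: subdivision_vertex_join_def)
  have sub: "arcs ?J \<subseteq> verts ?J \<times> verts ?J"
    by (auto simp: subdivision_vertex_join_def arcs_ends_def arc_to_ends_def)
       (auto simp: subdivision_digraph_def)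
  have irr: "fst e \<noteq> snd e" if "e \<in> arcs ?J" for e
    using that S.no_loops D2.no_loops
    by (auto simp: subdivision_vertex_join_def arcs_ends_def arc_to_ends_def)
  have th: "tail ?J = fst" "head ?J = snd" by (simp_all add: subdivision_vertex_join_def)
  have "finite (arcs ?J)" using sub vf by (meson finite_SigmaI finite_subset)
  hence "digraph ?J"
    using sub irr vf by unfold_locales (auto simp: th arc_to_ends_def)
  thus ?thesis using assms by (auto simp: nonempty_digraph_def subdivision_vertex_join_def
      subdivision_digraph_def)
qed


section \<open>Matrices of a digraph\<close>

text \<open>An arbitrary but fixed labelling of the vertices.\<close>

definition vertex_list :: "('a, 'b) pre_digraph \<Rightarrow> 'a list" where
  "vertex_list D = (SOME vs. distinct vs \<and> set vs = verts D)"

lemma vertex_list: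
  assumes "finite (verts D)"
  shows "distinct (vertex_list D)" "set (vertex_list D) = verts D"
    "length (vertex_list D) = card (verts D)"
proof -
  have "\<exists>vs. distinct vs \<and> set vs = verts D"
    using finite_distinct_list[OF assms] by blast
  hence *: "distinct (vertex_list D) \<and> set (vertex_list D) = verts D"
    unfolding vertex_list_def by (rule someI_ex)
  thus "distinct (vertex_list D)" "set (vertex_list D) = verts D" by auto
  with distinct_card show "length (vertex_list D) = card (verts D)" by metis
qed

definition adjacency_matrix :: "('a, 'b) pre_digraph \<Rightarrow> real mat" where
  "adjacency_matrix D = mat (card (verts D)) (card (verts D))
     (\<lambda>(i, j). if vertex_list D ! i \<rightarrow>\<^bsub>D\<^esub> vertex_list D ! j then 1 else 0)"

definition out_degree_matrix :: "('a, 'b) pre_digraph \<Rightarrow> real mat" where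
  "out_degree_matrix D = mat (card (verts D)) (card (verts D))
     (\<lambda>(i, j). if i = j then real (out_degree D (vertex_list D ! i)) else 0)"

definition laplacian_matrix :: "('a, 'b) pre_digraph \<Rightarrow> real mat" where
  "laplacian_matrix D = out_degree_matrix D - adjacency_matrix D"

definition signless_laplacian_matrix :: "('a, 'b) pre_digraph \<Rightarrow> real mat" where
  "signless_laplacian_matrix D = out_degree_matrix D + adjacency_matrix D"


section \<open>Rational functions\<close>

type_synonym ratfun = "complex poly fract"

definition indet :: ratfun where
  "indet = to_fract [:0, 1:]"

definition const_ratfun :: "complex \<Rightarrow> ratfun" where
  "const_ratfun c = to_fract [:c:]"

definition poly_subst :: "complex poly \<Rightarrow> ratfun \<Rightarrow> ratfun" where
  "poly_subst p g = poly (map_poly const_ratfun p) g"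

text \<open>Substitution of \<open>g\<close> for the indeterminate in \<open>q\<close>. As usual this is only meaningful if
  \<open>q\<close> has a representation as a fraction whose denominator does not vanish at \<open>g\<close>, which is
  always the case for non-constant \<open>g\<close>.\<close>

definition ratfun_subst :: "ratfun \<Rightarrow> ratfun \<Rightarrow> ratfun" where
  "ratfun_subst q g = (THE y. \<exists>a b. q = Fract a b \<and> poly_subst b g \<noteq> 0 \<and>
     y = poly_subst a g / poly_subst b g)"

lemma const_ratfun_hom:
  "const_ratfun 0 = 0" "const_ratfun 1 = 1"
  "const_ratfun (a + b) = const_ratfun a + const_ratfun b"
  "const_ratfun (a * b) = const_ratfun a * const_ratfun b"
  by (simp_all add: const_ratfun_def flip: to_fract_add to_fract_mult one_pCons)

lemma poly_subst_0 [simp]: "poly_subst 0 g = 0"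
  by (simp add: poly_subst_def)

lemma poly_subst_pCons [simp]:
  "poly_subst (pCons a p) g = const_ratfun a + g * poly_subst p g"
  by (cases "a = 0 \<and> p = 0") (auto simp: poly_subst_def map_poly_pCons const_ratfun_hom)

lemma poly_subst_1 [simp]: "poly_subst 1 g = 1"
  by (simp add: one_pCons const_ratfun_hom)

lemma poly_subst_add: "poly_subst (p + q) g = poly_subst p g + poly_subst q g"
  by (induction p q rule: poly_induct2) (simp_all add: const_ratfun_hom algebra_simps)

lemma poly_subst_smult: "poly_subst (Polynomial.smult c p) g = const_ratfun c * poly_subst p g"
  by (induction p) (simp_all add: const_ratfun_hom algebra_simps)

lemma poly_subst_mult: "poly_subst (p * q) g = poly_subst p g * poly_subst q g"
  by (induction p) (simp_all add: poly_subst_add poly_subst_smult const_ratfun_hom algebra_simps)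

lemma poly_subst_to_fract: "poly_subst p (to_fract g) = to_fract (pcompose p g)"
  by (induction p) (simp_all add: pcompose_pCons const_ratfun_def)

lemma ratfun_subst_Fract:
  assumes "poly_subst b g \<noteq> 0"
  shows "ratfun_subst (Fract a b) g = poly_subst a g / poly_subst b g"
  unfolding ratfun_subst_def
proof (rule the_equality)
  fix y assume "\<exists>c d. Fract a b = Fract c d \<and> poly_subst d g \<noteq> 0 \<and>
    y = poly_subst c g / poly_subst d g"
  then obtain c d where cd: "Fract a b = Fract c d" "poly_subst d g \<noteq> 0"
    "y = poly_subst c g / poly_subst d g" by blast
  have "b \<noteq> 0" "d \<noteq> 0" using assms cd(2) by auto
  hence "a * d = c * b" using cd(1) by (simp add: eq_fract)
  hence "poly_subst a g * poly_subst d g = poly_subst c g * poly_subst b g"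
    by (metis poly_subst_mult)
  thus "y = poly_subst a g / poly_subst b g" using assms cd by (simp add: frac_eq_eq)
qed (use assms in blast)

lemma ratfun_subst_to_fract: "ratfun_subst (to_fract p) g = poly_subst p g"
  using ratfun_subst_Fract[of 1 g p] by (simp add: to_fract_def)


section \<open>Characteristic polynomials, coronals and spectra\<close>

definition charpoly_complex :: "real mat \<Rightarrow> complex poly" where
  "charpoly_complex M = char_poly (map_mat complex_of_real M)"

text \<open>\<^const>\<open>mat_inverse\<close> returns an option; the matrix \<open>\<lambda>I - M\<close> is always invertible over
  the field of rational functions.\<close>

definition coronal :: "real mat \<Rightarrow> ratfun" where
  "coronal M =
    (let n = dim_row M;
         N = the (mat_inverse
               (indet \<cdot>\<^sub>m 1\<^sub>m n - map_mat (\<lambda>a. const_ratfun (complex_of_real a)) M))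
     in vec n (\<lambda>_. 1) \<bullet> (N *\<^sub>v vec n (\<lambda>_. 1)))"

definition L_charpoly :: "('a, 'b) pre_digraph \<Rightarrow> ratfun" where
  "L_charpoly D = to_fract (charpoly_complex (laplacian_matrix D))"

definition Q_charpoly :: "('a, 'b) pre_digraph \<Rightarrow> ratfun" where
  "Q_charpoly D = to_fract (charpoly_complex (signless_laplacian_matrix D))"

definition Q_coronal :: "('a, 'b) pre_digraph \<Rightarrow> ratfun" where
  "Q_coronal D = coronal (signless_laplacian_matrix D)"

definition L_spectrum :: "('a, 'b) pre_digraph \<Rightarrow> complex multiset" where
  "L_spectrum D = proots (charpoly_complex (laplacian_matrix D))"

definition Q_spectrum :: "('a, 'b) pre_digraph \<Rightarrow> complex multiset" where
  "Q_spectrum D = proots (charpoly_complex (signless_laplacian_matrix D))"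

end

theory Submission
  imports Defs
begin

text \<open>
  Both formulas are instances of one. For \<open>s = -1\<close> and \<open>s = 1\<close> the matrix
  \<open>D\<^sub>o\<^sub>u\<^sub>t + s A\<close> is the Laplacian and the signless Laplacian, and the
  computation of its characteristic polynomial uses only \<open>s\<^sup>2 = 1\<close>.
  Group the vertices of the join into the arc vertices \<open>E\<close>, the vertices \<open>V\<close> of \<open>D1\<close> and the
  vertices \<open>W\<close> of \<open>D2\<close>. The matrix \<open>x I - (D\<^sub>o\<^sub>u\<^sub>t + s A)\<close> of the join is then, up to the factor
  \<open>-s\<close> on the blocks off the diagonal,
  \<open>(x - 1) I\<close> on \<open>E\<close>, \<open>(x - r - n2) I\<close> on \<open>V\<close> and \<open>N = (x - n1) I - (D\<^sub>o\<^sub>u\<^sub>t + s A)(D2)\<close> on \<open>W\<close>,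
  with the two incidence matrices between \<open>V\<close> and \<open>E\<close> and all-ones blocks between \<open>V\<close> and \<open>W\<close>.

  Three eliminations compute its determinant. Eliminating \<open>E\<close> costs \<open>(x - 1) ^ (n1 * r)\<close> and subtracts
  \<open>A(D1) / (x - 1)\<close> from the block on \<open>V\<close>, since the product of the incidence matrices is the
  adjacency matrix. What is left on \<open>V\<close> is, up to scaling, \<open>D1\<close>'s characteristic matrix at the
  point in the statement; because \<open>D1\<close> is out-regular, the all-ones vector is an eigenvector of it,
  so eliminating \<open>V\<close> subtracts a constant \<open>t\<close> from all entries of \<open>N\<close>. Finally
  \<open>det (N - t J) = det N * (1 - t * 1\<^sup>T N\<^sup>-\<^sup>1 1)\<close>, and \<open>1\<^sup>T N\<^sup>-\<^sup>1 1\<close> is the coronal of \<open>D2\<close> at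
  \<open>x - n1\<close>. For the Laplacian all row sums of \<open>N\<close> are \<open>x - n1\<close>, so it is \<open>n2 / (x - n1)\<close>. The
  eliminations are \<open>det_on_subdivision_vertex_join\<close>; \<open>charpoly_join\<close> applies them to digraphs.

  The right-hand sides depend on \<open>D1\<close> and \<open>D2\<close> only through their characteristic polynomials, the
  numbers \<open>n1\<close>, \<open>n2\<close> and \<open>r\<close>, and in the signless case the coronal. A spectrum determines the
  characteristic polynomial, which is monic and splits over the complex numbers; its degree is the
  number of vertices, and for an out-regular digraph its second coefficient is
  \<open>- n1 * r\<close> by the trace. This is \<open>regular_data_of_charpoly\<close>.
\<close>

section \<open>Determinants over finite index sets\<close>

text \<open>The determinant, by Leibniz's formula, with a finite set as index set of rows and columns. The
  statements about digraphs concern an unspecified numbering of the vertices; this form makes them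
  independent of it, and lets block decompositions be decompositions of the vertex set.\<close>

definition det_on :: "'a set \<Rightarrow> ('a \<Rightarrow> 'a \<Rightarrow> 'k :: comm_ring_1) \<Rightarrow> 'k" where
  "det_on S F = (\<Sum>p | p permutes S. of_int (sign p) * (\<Prod>i\<in>S. F i (p i)))"

lemma det_on_cong:
  assumes "S = T" "\<And>i j. i \<in> T \<Longrightarrow> j \<in> T \<Longrightarrow> F i j = G i j"
  shows "det_on S F = det_on T G"
  unfolding det_on_def assms(1)
  by (intro sum.cong prod.cong arg_cong2[where f = "(*)"] refl) (auto simp: assms permutes_in_image)

text \<open>Transporting permutations along a bijection preserves their signs.\<close>

lemma det_on_reindex:
  assumes "finite S" "bij_betw f S T"
  shows "det_on S (\<lambda>i j. F (f i) (f j)) = det_on T F"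
proof -
  have inj: "inj_on f S" and T: "T = f ` S"
    using assms(2) by (auto simp: bij_betw_def)
  note app = map_permutation_apply[OF inj]
  show ?thesis unfolding det_on_def
  proof (rule sum.reindex_bij_witness[of _ "map_permutation T (inv_into S f)" "map_permutation S f"])
    fix p assume "p \<in> {p. p permutes S}"
    hence p: "p permutes S" by simp
    show "map_permutation T (inv_into S f) (map_permutation S f p) = p"
      by (rule map_permutation_compose_inv[OF assms(2) p]) (use inj in auto)
    show "map_permutation S f p \<in> {p. p permutes T}"
      using map_permutation_permutes[OF assms(2) p] by simp
    have "(\<Prod>j\<in>T. F j (map_permutation S f p j)) = (\<Prod>i\<in>S. F (f i) (f (p i)))"
      unfolding T prod.reindex[OF inj] o_def by (rule prod.cong) (auto simp: app)
    thus "of_int (sign (map_permutation S f p)) * (\<Prod>j\<in>T. F j (map_permutation S f p j))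
        = of_int (sign p) * (\<Prod>i\<in>S. F (f i) (f (p i)))"
      using sign_map_permutation[OF inj p assms(1)] by simp
  next
    fix q assume "q \<in> {q. q permutes T}"
    hence q: "q permutes T" by simp
    have b: "bij_betw (inv_into S f) T S" using assms(2) by (rule bij_betw_inv_into)
    show "map_permutation S f (map_permutation T (inv_into S f) q) = q"
      by (rule map_permutation_compose_inv[OF b q]) (auto simp: T f_inv_into_f)
    show "map_permutation T (inv_into S f) q \<in> {p. p permutes S}"
      using map_permutation_permutes[OF b q] by simp
  qed
qed

lemma det_on_matrix: "det_on {0..<n} F = det (mat n n (\<lambda>(i, j). F i j))"
proof -
  have "p i < n" if "p permutes {0..<n}" "i < n" for p :: "nat \<Rightarrow> nat" and i
    using permutes_in_image[OF that(1), of i] that(2) by auto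
  thus ?thesis unfolding det_on_def det_def
    by (auto intro!: sum.cong prod.cong arg_cong2[where f = "(*)"])
qed

lemma det_on_mult:
  assumes "finite S"
  shows "det_on S (\<lambda>a b. \<Sum>c\<in>S. F a c * G c b) = det_on S F * det_on S G"
proof -
  obtain f where f: "bij_betw f {0..<card S} S"
    using ex_bij_betw_nat_finite[OF assms] by blast
  let ?n = "card S"
  let ?M = "\<lambda>H. mat ?n ?n (\<lambda>(i, j). H (f i) (f j))"
  have eq: "det_on S H = det (?M H)" for H
    using det_on_reindex[OF _ f, of H] det_on_matrix[of ?n "\<lambda>i j. H (f i) (f j)"] by simp
  have "?M (\<lambda>a b. \<Sum>c\<in>S. F a c * G c b) = ?M F * ?M G"
    by (rule eq_matI) (simp_all add: scalar_prod_def sum.reindex_bij_betw[OF f, symmetric])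
  thus ?thesis unfolding eq by (simp add: det_mult[of _ ?n])
qed

lemma det_on_smult: "det_on S (\<lambda>a b. c * F a b) = c ^ card S * det_on S F"
  by (simp add: det_on_def prod.distrib sum_distrib_left mult_ac)

lemma det_on_block_triangular:
  fixes F :: "'a \<Rightarrow> 'a \<Rightarrow> 'k :: idom"
  assumes "finite S" "finite T" "S \<inter> T = {}"
    and zero: "\<And>a b. a \<in> S \<Longrightarrow> b \<in> T \<Longrightarrow> F a b = 0"
  shows "det_on (S \<union> T) F = det_on S F * det_on T F"
proof -
  let ?m = "card S" and ?n = "card T"
  obtain f g where f: "bij_betw f {0..<?m} S" and g: "bij_betw g {0..<?n} T"
    using ex_bij_betw_nat_finite assms(1,2) by meson
  define h where "h i = (if i < ?m then f i else g (i - ?m))" for i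
  have "bij_betw h ({0..<?m} \<union> {?m..<?m + ?n}) (S \<union> T)"
  proof (rule bij_betw_combine)
    show "bij_betw h {0..<?m} S"
      by (subst bij_betw_cong[of _ _ f]) (auto simp: h_def f)
    have "bij_betw (\<lambda>i. i - ?m) {?m..<?m + ?n} {0..<?n}"
      by (rule bij_betw_byWitness[of _ "\<lambda>i. i + ?m"]) auto
    from bij_betw_trans[OF this g] show "bij_betw h {?m..<?m + ?n} T"
      by (subst bij_betw_cong[of _ _ "g \<circ> (\<lambda>i. i - ?m)"]) (auto simp: h_def)
  qed (use assms(3) in auto)
  moreover have "{0..<?m} \<union> {?m..<?m + ?n} = {0..<?m + ?n}" by auto
  ultimately have h: "bij_betw h {0..<?m + ?n} (S \<union> T)" by simp
  let ?A = "mat ?m ?m (\<lambda>(i, j). F (f i) (f j))"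
  let ?C = "mat ?n ?m (\<lambda>(i, j). F (g i) (f j))"
  let ?D = "mat ?n ?n (\<lambda>(i, j). F (g i) (g j))"
  have mem: "f i \<in> S" if "i < ?m" for i using f that by (auto simp: bij_betw_def)
  have mem': "g i \<in> T" if "i < ?n" for i using g that by (auto simp: bij_betw_def)
  have "det_on (S \<union> T) F = det (mat (?m + ?n) (?m + ?n) (\<lambda>(i, j). F (h i) (h j)))"
    using det_on_reindex[OF _ h, of F] det_on_matrix[of "?m + ?n" "\<lambda>i j. F (h i) (h j)"] by simp
  also have "mat (?m + ?n) (?m + ?n) (\<lambda>(i, j). F (h i) (h j)) = four_block_mat ?A (0\<^sub>m ?m ?n) ?C ?D"
    by (rule eq_matI) (auto simp: h_def mem mem' zero)
  also have "det \<dots> = det ?A * det ?D"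
    by (rule det_four_block_mat_upper_right_zero[where n = ?m and m = ?n]) auto
  also have "det ?A = det_on S F"
    using det_on_reindex[OF _ f, of F] det_on_matrix[of ?m "\<lambda>i j. F (f i) (f j)"] by simp
  also have "det ?D = det_on T F"
    using det_on_reindex[OF _ g, of F] det_on_matrix[of ?n "\<lambda>i j. F (g i) (g j)"] by simp
  finally show ?thesis .
qed

lemma det_on_transpose:
  assumes "finite S"
  shows "det_on S (\<lambda>a b. F b a) = det_on S F"
proof -
  obtain f where f: "bij_betw f {0..<card S} S"
    using ex_bij_betw_nat_finite[OF assms] by blast
  let ?n = "card S"
  have "mat ?n ?n (\<lambda>(i, j). F (f j) (f i)) = transpose_mat (mat ?n ?n (\<lambda>(i, j). F (f i) (f j)))"
    by (rule eq_matI) auto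
  thus ?thesis
    using det_on_reindex[OF _ f, of F] det_on_matrix[of ?n "\<lambda>i j. F (f i) (f j)"]
      det_on_reindex[OF _ f, of "\<lambda>a b. F b a"] det_on_matrix[of ?n "\<lambda>i j. F (f j) (f i)"]
      det_transpose[of "mat ?n ?n (\<lambda>(i, j). F (f i) (f j))" ?n]
    by simp
qed

lemma det_on_identity:
  assumes "finite S"
  shows "det_on S (\<lambda>a b. if a = b then 1 else 0) = (1 :: 'k :: comm_ring_1)"
proof -
  obtain f where f: "bij_betw f {0..<card S} S"
    using ex_bij_betw_nat_finite[OF assms] by blast
  let ?n = "card S"
  have "mat ?n ?n (\<lambda>(i, j). if f i = f j then 1 else 0) = (1\<^sub>m ?n :: 'k mat)"
    using f by (intro eq_matI) (auto simp: bij_betw_def inj_on_def)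
  thus ?thesis
    using det_on_reindex[OF _ f, of "\<lambda>a b. if a = b then (1 :: 'k) else 0"]
      det_on_matrix[of ?n "\<lambda>i j. if f i = f j then (1 :: 'k) else 0"] by simp
qed

text \<open>Schur complement without an inverse: if the upper right block of \<open>F\<close> is \<open>A U\<close>, where \<open>A\<close> is the
  upper left one, then subtracting the first block column times \<open>U\<close> from the second makes \<open>F\<close>
  block triangular. In the proof \<open>G\<close> is the unitriangular matrix with upper right block \<open>-U\<close>.\<close>

lemma det_on_schur:
  fixes F :: "'a \<Rightarrow> 'a \<Rightarrow> 'k :: idom"
  assumes fin: "finite S" "finite T" and disj: "S \<inter> T = {}"
    and U: "\<And>a d. a \<in> S \<Longrightarrow> d \<in> T \<Longrightarrow> (\<Sum>c\<in>S. F a c * U c d) = F a d"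
  shows "det_on (S \<union> T) F = det_on S F * det_on T (\<lambda>b d. F b d - (\<Sum>c\<in>S. F b c * U c d))"
proof -
  define G where "G a b = (if a = b then 1 else if a \<in> S \<and> b \<in> T then - U a b else 0)" for a b
  have G: "det_on (S \<union> T) G = 1"
  proof -
    have "det_on (S \<union> T) G = det_on (S \<union> T) (\<lambda>a b. G b a)"
      by (rule det_on_transpose[symmetric]) (use fin in simp)
    also have "\<dots> = det_on S (\<lambda>a b. G b a) * det_on T (\<lambda>a b. G b a)"
      by (rule det_on_block_triangular) (use fin disj in \<open>auto simp: G_def\<close>)
    also have "det_on S (\<lambda>a b. G b a) = det_on S (\<lambda>a b. if a = b then 1 else 0)"
      by (rule det_on_cong) (use disj in \<open>auto simp: G_def\<close>)
    also have "det_on T (\<lambda>a b. G b a) = det_on T (\<lambda>a b. if a = b then 1 else 0)"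
      by (rule det_on_cong) (use disj in \<open>auto simp: G_def\<close>)
    finally show ?thesis by (simp add: det_on_identity fin)
  qed
  have FG: "(\<Sum>c\<in>S \<union> T. F a c * G c b) =
      (if b \<in> T then F a b - (\<Sum>c\<in>S. F a c * U c b) else F a b)" if "b \<in> S \<union> T" for a b
  proof -
    have "(\<Sum>c\<in>S. F a c * G c b) = (if b \<in> T then - (\<Sum>c\<in>S. F a c * U c b) else F a b)"
    proof (cases "b \<in> T")
      case True
      have "(\<Sum>c\<in>S. F a c * G c b) = (\<Sum>c\<in>S. - (F a c * U c b))"
        by (rule sum.cong) (use True disj in \<open>auto simp: G_def\<close>)
      thus ?thesis using True by (simp add: sum_negf)
    next
      case False
      have "(\<Sum>c\<in>S. F a c * G c b) = (\<Sum>c\<in>S. if c = b then F a c else 0)"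
        by (rule sum.cong) (use False in \<open>auto simp: G_def\<close>)
      thus ?thesis using False that fin by simp
    qed
    moreover have "(\<Sum>c\<in>T. F a c * G c b) = (\<Sum>c\<in>T. if c = b then F a c else 0)"
      by (rule sum.cong) (use disj in \<open>auto simp: G_def\<close>)
    ultimately show ?thesis using fin disj by (simp add: sum.union_disjoint)
  qed
  have "det_on (S \<union> T) F = det_on (S \<union> T) F * det_on (S \<union> T) G" by (simp add: G)
  also have "\<dots> = det_on (S \<union> T) (\<lambda>a b. \<Sum>c\<in>S \<union> T. F a c * G c b)"
    by (rule det_on_mult[symmetric]) (use fin in simp)
  also have "\<dots> = det_on S (\<lambda>a b. \<Sum>c\<in>S \<union> T. F a c * G c b)
      * det_on T (\<lambda>a b. \<Sum>c\<in>S \<union> T. F a c * G c b)"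
    by (rule det_on_block_triangular) (use fin disj U in \<open>auto simp: FG\<close>)
  also have "det_on S (\<lambda>a b. \<Sum>c\<in>S \<union> T. F a c * G c b) = det_on S F"
    by (rule det_on_cong) (use disj in \<open>auto simp: FG\<close>)
  also have "det_on T (\<lambda>a b. \<Sum>c\<in>S \<union> T. F a c * G c b)
      = det_on T (\<lambda>b d. F b d - (\<Sum>c\<in>S. F b c * U c d))"
    by (rule det_on_cong) (auto simp: FG)
  finally show ?thesis .
qed

lemma det_on_image:
  assumes "finite S" "inj_on f S"
  shows "det_on (f ` S) F = det_on S (\<lambda>i j. F (f i) (f j))"
  using det_on_reindex[OF assms(1) inj_on_imp_bij_betw[OF assms(2)], of F] by simp

lemma det_on_singleton: "det_on {a} F = F a a"
  by (simp add: det_on_def)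

lemma det_on_scalar:
  assumes "finite S"
  shows "det_on S (\<lambda>a b. if a = b then y else 0) = y ^ card S"
proof -
  have "det_on S (\<lambda>a b. if a = b then y else 0)
      = det_on S (\<lambda>a b. y * (if a = b then 1 else 0))"
    by (rule det_on_cong) auto
  thus ?thesis by (simp add: det_on_smult det_on_identity assms)
qed

text \<open>A special case of the matrix determinant lemma. The bordered matrix with blocks \<open>M\<close>, \<open>1\<close>, \<open>t 1\<^sup>T\<close>
  and corner \<open>1\<close>, indexed by the option type, has two Schur complements: with respect to \<open>M\<close>,
  where \<open>u\<close> solves \<open>M u = 1\<close>, and with respect to the corner. Comparing them gives the identity.\<close>

lemma det_on_minus_const:
  fixes M :: "'a \<Rightarrow> 'a \<Rightarrow> 'k :: idom"
  assumes fin: "finite S" and u: "\<And>a. a \<in> S \<Longrightarrow> (\<Sum>b\<in>S. M a b * u b) = 1"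
  shows "det_on S (\<lambda>a b. M a b - t) = det_on S M * (1 - t * (\<Sum>b\<in>S. u b))"
proof -
  define H where "H a b = (case a of
      Some a \<Rightarrow> (case b of Some b \<Rightarrow> M a b | None \<Rightarrow> 1)
    | None \<Rightarrow> (case b of Some b \<Rightarrow> t | None \<Rightarrow> 1))" for a b
  have [simp]: "H (Some a) (Some b) = M a b" "H (Some a) None = 1"
    "H None (Some b) = t" "H None None = 1" for a b by (simp_all add: H_def)
  have [simp]: "(\<Sum>c\<in>Some ` S. f c) = (\<Sum>c\<in>S. f (Some c))" for f :: "'a option \<Rightarrow> 'k"
    by (simp add: sum.reindex)
  have img: "det_on (Some ` S) F = det_on S (\<lambda>a b. F (Some a) (Some b))"
    for F :: "'a option \<Rightarrow> 'a option \<Rightarrow> 'k" by (rule det_on_image) (use fin in auto)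
  have "det_on (Some ` S \<union> {None}) H = det_on (Some ` S) H *
      det_on {None} (\<lambda>b d. H b d - (\<Sum>c\<in>Some ` S. H b c * (u \<circ> the) c))"
    by (rule det_on_schur) (use fin u in auto)
  also have "\<dots> = det_on S M * (1 - t * (\<Sum>b\<in>S. u b))"
    unfolding img by (simp add: det_on_singleton sum_distrib_left)
  finally have *: "det_on (Some ` S \<union> {None}) H = \<dots>" .
  have "det_on ({None} \<union> Some ` S) H = det_on {None} H *
      det_on (Some ` S) (\<lambda>b d. H b d - (\<Sum>c\<in>{None}. H b c * t))"
    by (rule det_on_schur) (use fin in auto)
  also have "\<dots> = det_on S (\<lambda>a b. M a b - t)"
    unfolding img by (simp add: det_on_singleton)
  finally show ?thesis using * by (simp only: Un_commute)
qed

text \<open>The computation for the join, over an arbitrary field: \<open>B\<close> and \<open>C\<close> play the role of the tail and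
  head incidence matrices, \<open>A = B C\<close> that of the adjacency matrix, and \<open>s\<close> is the common sign of
  the blocks off the diagonal. The factor \<open>y ^ card V\<close> on the left clears the denominators that
  the elimination of \<open>E\<close> puts into the block on \<open>V\<close>.\<close>

lemma det_on_subdivision_vertex_join:
  fixes F :: "('a + 'b) + 'c \<Rightarrow> ('a + 'b) + 'c \<Rightarrow> 'k :: field"
  assumes fin: "finite V" "finite E" "finite W"
    and VV: "\<And>v v'. v \<in> V \<Longrightarrow> v' \<in> V \<Longrightarrow> F (Inl (Inl v)) (Inl (Inl v')) = (if v = v' then a else 0)"
    and VE: "\<And>v e. v \<in> V \<Longrightarrow> e \<in> E \<Longrightarrow> F (Inl (Inl v)) (Inl (Inr e)) = s * B v e"
    and VW: "\<And>v w. v \<in> V \<Longrightarrow> w \<in> W \<Longrightarrow> F (Inl (Inl v)) (Inr w) = s"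
    and EV: "\<And>v e. v \<in> V \<Longrightarrow> e \<in> E \<Longrightarrow> F (Inl (Inr e)) (Inl (Inl v)) = s * C e v"
    and EE: "\<And>e e'. e \<in> E \<Longrightarrow> e' \<in> E \<Longrightarrow> F (Inl (Inr e)) (Inl (Inr e')) = (if e = e' then y else 0)"
    and EW: "\<And>e w. e \<in> E \<Longrightarrow> w \<in> W \<Longrightarrow> F (Inl (Inr e)) (Inr w) = 0"
    and WV: "\<And>v w. v \<in> V \<Longrightarrow> w \<in> W \<Longrightarrow> F (Inr w) (Inl (Inl v)) = s"
    and WE: "\<And>e w. e \<in> E \<Longrightarrow> w \<in> W \<Longrightarrow> F (Inr w) (Inl (Inr e)) = 0"
    and WW: "\<And>w w'. w \<in> W \<Longrightarrow> w' \<in> W \<Longrightarrow> F (Inr w) (Inr w') = N w w'"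
    and s: "s * s = 1" and y: "y \<noteq> 0"
    and BC: "\<And>v v'. v \<in> V \<Longrightarrow> v' \<in> V \<Longrightarrow> (\<Sum>e\<in>E. B v e * C e v') = A v v'"
    and row: "\<And>v. v \<in> V \<Longrightarrow> (\<Sum>v'\<in>V. A v v') = r"
    and nz: "a * y - r \<noteq> 0"
    and u: "\<And>w. w \<in> W \<Longrightarrow> (\<Sum>w'\<in>W. N w w' * u w') = 1"
  shows "y ^ card V * det_on (Inl ` (Inl ` V \<union> Inr ` E) \<union> Inr ` W) F =
    y ^ card E * det_on V (\<lambda>v v'. (if v = v' then a * y else 0) - A v v') * det_on W N
    * (1 - y * of_nat (card V) / (a * y - r) * (\<Sum>w\<in>W. u w))"
proof -
  let ?V = "(\<lambda>v. Inl (Inl v)) ` V :: (('a + 'b) + 'c) set"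
    and ?E = "(\<lambda>e. Inl (Inr e)) ` E :: (('a + 'b) + 'c) set"
    and ?W = "Inr ` W :: (('a + 'b) + 'c) set"
  \<comment> \<open>the eigenvalue of the block on \<open>V\<close> for the all-ones vector, after \<open>E\<close> has been eliminated\<close>
  define d where "d = a - r / y"
  have d: "d \<noteq> 0" "d * y = a * y - r" using nz y by (auto simp: d_def field_simps)
  have imgV: "det_on ?V H = det_on V (\<lambda>i j. H (Inl (Inl i)) (Inl (Inl j)))"
    and imgE: "det_on ?E H = det_on E (\<lambda>i j. H (Inl (Inr i)) (Inl (Inr j)))"
    and imgW: "det_on ?W H = det_on W (\<lambda>i j. H (Inr i) (Inr j))"
    for H :: "('a + 'b) + 'c \<Rightarrow> ('a + 'b) + 'c \<Rightarrow> 'k"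
    by (rule det_on_image, use fin in \<open>auto simp: inj_on_def\<close>)+
  have sumE: "(\<Sum>c\<in>?E. f c) = (\<Sum>e\<in>E. f (Inl (Inr e)))"
    and sumV: "(\<Sum>c\<in>?V. f c) = (\<Sum>v\<in>V. f (Inl (Inl v)))"
    for f :: "('a + 'b) + 'c \<Rightarrow> 'k" by (auto simp: sum.reindex inj_on_def)
  \<comment> \<open>the Schur complement with respect to \<open>E\<close>\<close>
  define G where "G b d = F b d - (\<Sum>c\<in>?E. F b c * (F c d / y))" for b d
  have "det_on (?E \<union> (?V \<union> ?W)) F = det_on ?E F * det_on (?V \<union> ?W) G"
    unfolding G_def
  proof (rule det_on_schur)
    fix b d assume b: "b \<in> ?E" and "d \<in> ?V \<union> ?W"
    then obtain e where e: "e \<in> E" "b = Inl (Inr e)" by auto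
    have "(\<Sum>c\<in>?E. F b c * (F c d / y))
        = (\<Sum>c\<in>E. if e = c then F (Inl (Inr c)) d else 0)"
      unfolding sumE by (rule sum.cong) (use e EE y in auto)
    also have "\<dots> = F b d" using e fin by simp
    finally show "(\<Sum>c\<in>?E. F b c * (F c d / y)) = F b d" .
  qed (use fin in auto)
  also have "det_on ?E F = det_on E (\<lambda>e e'. if e = e' then y else 0)"
    unfolding imgE by (rule det_on_cong) (simp_all add: EE)
  also have "\<dots> = y ^ card E" using fin by (simp add: det_on_scalar)
  finally have 1: "det_on (?E \<union> (?V \<union> ?W)) F = y ^ card E * det_on (?V \<union> ?W) G" .
  have GVV: "G (Inl (Inl v)) (Inl (Inl v')) = (if v = v' then a else 0) - A v v' / y"
    if "v \<in> V" "v' \<in> V" for v v'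
  proof -
    have "(\<Sum>e\<in>E. F (Inl (Inl v)) (Inl (Inr e)) * (F (Inl (Inr e)) (Inl (Inl v')) / y))
      = (\<Sum>e\<in>E. (s * s) * (B v e * C e v') / y)"
      by (rule sum.cong) (use that VE EV in \<open>auto simp: field_simps\<close>)
    also have "\<dots> = A v v' / y"
      using BC[OF that] by (simp add: s flip: sum_divide_distrib)
    finally show ?thesis using that by (simp add: G_def sumE VV)
  qed
  have GVW: "G (Inl (Inl v)) (Inr w) = s" "G (Inr w) (Inl (Inl v)) = s" if "v \<in> V" "w \<in> W" for v w
    using that by (simp_all add: G_def sumE VW WV EW WE)
  have GWW: "G (Inr w) (Inr w') = N w w'" if "w \<in> W" "w' \<in> W" for w w'
    using that by (simp add: G_def sumE WW EW)
  \<comment> \<open>constant row sums on \<open>V\<close> make the constant matrix \<open>s / d\<close> a solution\<close>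
  have "det_on (?V \<union> ?W) G = det_on ?V G * det_on ?W (\<lambda>b e. G b e - (\<Sum>c\<in>?V. G b c * (s / d)))"
  proof (rule det_on_schur)
    fix b e assume "b \<in> ?V" "e \<in> ?W"
    then obtain v w where vw: "v \<in> V" "w \<in> W" "b = Inl (Inl v)" "e = Inr w" by auto
    have "(\<Sum>c\<in>?V. G b c * (s / d)) = (\<Sum>c\<in>V. ((if v = c then a else 0) - A v c / y)) * (s / d)"
      unfolding sumV sum_distrib_right by (rule sum.cong) (use vw GVV in auto)
    also have "(\<Sum>c\<in>V. ((if v = c then a else 0) - A v c / y)) = d"
      using vw fin by (simp add: sum_subtractf row d_def flip: sum_divide_distrib)
    finally show "(\<Sum>c\<in>?V. G b c * (s / d)) = G b e" using vw d by (simp add: GVW)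
  qed (use fin in auto)
  also have "det_on ?W (\<lambda>b e. G b e - (\<Sum>c\<in>?V. G b c * (s / d)))
      = det_on W (\<lambda>w w'. N w w' - of_nat (card V) / d)"
    unfolding imgW sumV by (rule det_on_cong) (simp_all add: GVW GWW s)
  also have "\<dots> = det_on W N * (1 - of_nat (card V) / d * (\<Sum>w\<in>W. u w))"
    by (rule det_on_minus_const) (use fin u in auto)
  also have "of_nat (card V) / d = y * of_nat (card V) / (a * y - r)"
    using d y by (simp flip: d(2))
  finally have 2: "det_on (?V \<union> ?W) G = det_on ?V G *
    (det_on W N * (1 - y * of_nat (card V) / (a * y - r) * (\<Sum>w\<in>W. u w)))" .
  have "y ^ card V * det_on ?V G = det_on V (\<lambda>v v'. y * G (Inl (Inl v)) (Inl (Inl v')))"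
    unfolding imgV by (rule det_on_smult[symmetric])
  also have "\<dots> = det_on V (\<lambda>v v'. (if v = v' then a * y else 0) - A v v')"
    by (rule det_on_cong) (use y in \<open>auto simp: GVV field_simps\<close>)
  finally have 3: "y ^ card V * det_on ?V G = \<dots>" .
  have "Inl ` (Inl ` V \<union> Inr ` E) \<union> Inr ` W = ?E \<union> (?V \<union> ?W)" by auto
  thus ?thesis by (simp add: 1 2 flip: 3)
qed

section \<open>Substitution into characteristic polynomials and coronals\<close>

abbreviation real_const :: "real \<Rightarrow> ratfun" where
  "real_const a \<equiv> const_ratfun (complex_of_real a)"

lemma const_ratfun_uminus: "const_ratfun (- c) = - const_ratfun c"
  by (simp add: const_ratfun_def flip: to_fract_uminus)

lemma real_const_of_nat: "real_const (real n) = of_nat n"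
  by (induction n) (simp_all add: const_ratfun_hom)

lemma indet_minus_of_nat: "indet - of_nat k = to_fract [:- of_nat k, 1:]"
proof -
  have "(of_nat k :: ratfun) = to_fract [:of_nat k:]"
    using real_const_of_nat[of k] by (simp add: const_ratfun_def)
  thus ?thesis by (simp add: indet_def flip: to_fract_diff)
qed

lemma poly_subst_comm_ring_hom: "comm_ring_hom (\<lambda>p. poly_subst p g)"
  by unfold_locales (simp_all add: poly_subst_add poly_subst_mult)

text \<open>Substitution into polynomials is a ring homomorphism, hence commutes with determinants.\<close>

lemma ratfun_subst_charpoly:
  assumes M: "M \<in> carrier_mat n n"
  shows "ratfun_subst (to_fract (charpoly_complex M)) g
    = det_on {0..<n} (\<lambda>i j. (if i = j then g else 0) - real_const (M $$ (i, j)))"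
proof -
  interpret comm_ring_hom "\<lambda>p. poly_subst p g" by (rule poly_subst_comm_ring_hom)
  let ?P = "char_poly_matrix (map_mat complex_of_real M)"
  have "ratfun_subst (to_fract (charpoly_complex M)) g = det (map_mat (\<lambda>p. poly_subst p g) ?P)"
    by (simp add: ratfun_subst_to_fract charpoly_complex_def char_poly_def)
  also have "map_mat (\<lambda>p. poly_subst p g) ?P
      = mat n n (\<lambda>(i, j). (if i = j then g else 0) - real_const (M $$ (i, j)))"
    using M by (intro eq_matI)
      (auto simp: char_poly_matrix_def poly_subst_add const_ratfun_hom const_ratfun_uminus)
  finally show ?thesis by (simp add: det_on_matrix)
qed

lemma ratfun_subst_indet: "ratfun_subst (to_fract p) indet = to_fract p"
  by (simp add: ratfun_subst_to_fract indet_def poly_subst_to_fract pcompose_idR)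

text \<open>Substituting a polynomial of positive degree never kills a denominator, so it is defined on all
  rational functions.\<close>

lemma ratfun_subst_comm_ring_hom:
  assumes "degree h > 0"
  shows "comm_ring_hom (\<lambda>q. ratfun_subst q (to_fract h))"
proof -
  have nz: "poly_subst b (to_fract h) \<noteq> 0" if "b \<noteq> 0" for b
    using that assms by (simp add: poly_subst_to_fract pcompose_eq_0_iff)
  note sub = ratfun_subst_Fract[OF nz]
  show ?thesis
  proof
    show "ratfun_subst 0 (to_fract h) = 0" "ratfun_subst 1 (to_fract h) = 1"
      using ratfun_subst_to_fract[of 0] ratfun_subst_to_fract[of 1] by simp_all
    fix q1 q2 :: ratfun
    obtain a1 b1 a2 b2 where q: "q1 = Fract a1 b1" "b1 \<noteq> 0" "q2 = Fract a2 b2" "b2 \<noteq> 0"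
      using Fract_cases by metis
    show "ratfun_subst (q1 + q2) (to_fract h)
        = ratfun_subst q1 (to_fract h) + ratfun_subst q2 (to_fract h)"
      using q by (simp add: sub poly_subst_add poly_subst_mult add_frac_eq nz)
    show "ratfun_subst (q1 * q2) (to_fract h)
        = ratfun_subst q1 (to_fract h) * ratfun_subst q2 (to_fract h)"
      using q by (simp add: sub poly_subst_mult)
  qed
qed

text \<open>The vector \<open>u = (x I - M)\<^sup>-\<^sup>1 1\<close> behind the coronal, characterised by the linear system
  it solves, because a substitution can be applied to the entries of this system one by one.\<close>

lemma coronal_as_solution_sum:
  assumes M: "M \<in> carrier_mat n n"
  obtains u where
    "\<And>i. i < n \<Longrightarrow> (\<Sum>j<n. ((if i = j then indet else 0) - real_const (M $$ (i, j))) * u j) = 1"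
    "coronal M = (\<Sum>j<n. u j)"
proof -
  let ?X = "indet \<cdot>\<^sub>m 1\<^sub>m n - map_mat (\<lambda>a. real_const a) M"
  have X: "?X \<in> carrier_mat n n" using M by auto
  have "det ?X = det_on {0..<n} (\<lambda>i j. (if i = j then indet else 0) - real_const (M $$ (i, j)))"
    unfolding det_on_matrix using M by (intro arg_cong[where f = det] eq_matI) auto
  also have "\<dots> = to_fract (charpoly_complex M)"
    using ratfun_subst_charpoly[OF M, of indet] by (simp add: ratfun_subst_indet)
  also have "\<dots> \<noteq> 0"
    using degree_monic_char_poly[of "map_mat complex_of_real M" n] M
    by (auto simp: charpoly_complex_def)
  finally have "?X \<in> Units (ring_mat TYPE(ratfun) n ())"
    using det_non_zero_imp_unit[OF X, where b = "()"] by blast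
  then obtain N where N: "mat_inverse ?X = Some N"
    using mat_inverse(1)[OF X, where b = "()"] by blast
  hence XN: "?X * N = 1\<^sub>m n" "N \<in> carrier_mat n n"
    using mat_inverse(2)[OF X] by blast+
  define u where "u = N *\<^sub>v vec n (\<lambda>_. 1)"
  have u: "u \<in> carrier_vec n" using XN by (auto simp: u_def)
  have "?X *\<^sub>v u = vec n (\<lambda>_. 1)"
    using assoc_mult_mat_vec[OF X XN(2), of "vec n (\<lambda>_. 1)"] XN by (simp add: u_def)
  hence eq: "(?X *\<^sub>v u) $ i = 1" if "i < n" for i using that by simp
  show thesis
  proof (rule that[of "\<lambda>j. u $ j"])
    fix i assume i: "i < n"
    have "(\<Sum>j<n. ((if i = j then indet else 0) - real_const (M $$ (i, j))) * u $ j) = (?X *\<^sub>v u) $ i"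
      using i M u by (auto simp: scalar_prod_def atLeast0LessThan intro!: sum.cong)
    thus "(\<Sum>j<n. ((if i = j then indet else 0) - real_const (M $$ (i, j))) * u $ j) = 1"
      using eq i by simp
  next
    have "coronal M = vec n (\<lambda>_. 1) \<bullet> u"
      using M N by (simp add: coronal_def u_def)
    thus "coronal M = (\<Sum>j<n. u $ j)" using u by (simp add: scalar_prod_def atLeast0LessThan)
  qed
qed

lemma ratfun_subst_coronal:
  assumes M: "M \<in> carrier_mat n n" and h: "degree h > 0"
  obtains u where
    "\<And>i. i < n \<Longrightarrow> (\<Sum>j<n. ((if i = j then to_fract h else 0) - real_const (M $$ (i, j))) * u j) = 1"
    "ratfun_subst (coronal M) (to_fract h) = (\<Sum>j<n. u j)"
proof -
  interpret comm_ring_hom "\<lambda>q. ratfun_subst q (to_fract h)"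
    by (rule ratfun_subst_comm_ring_hom[OF h])
  obtain u where u:
    "\<And>i. i < n \<Longrightarrow> (\<Sum>j<n. ((if i = j then indet else 0) - real_const (M $$ (i, j))) * u j) = 1"
    "coronal M = (\<Sum>j<n. u j)"
    using coronal_as_solution_sum[OF M] by blast
  have [simp]: "ratfun_subst indet (to_fract h) = to_fract h"
    "ratfun_subst (const_ratfun c) (to_fract h) = const_ratfun c" for c
    by (simp_all add: indet_def const_ratfun_def ratfun_subst_to_fract poly_subst_to_fract)
  show thesis
  proof (rule that[of "\<lambda>j. ratfun_subst (u j) (to_fract h)"])
    fix i assume "i < n"
    from arg_cong[OF u(1)[OF this], of "\<lambda>q. ratfun_subst q (to_fract h)"]
    show "(\<Sum>j<n. ((if i = j then to_fract h else 0) - real_const (M $$ (i, j)))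
        * ratfun_subst (u j) (to_fract h)) = 1"
      by (simp add: hom_distribs if_distrib[of "\<lambda>q. ratfun_subst q _"] cong: if_cong)
  qed (simp add: u(2) hom_distribs)
qed

section \<open>Laplacians of digraphs\<close>

text \<open>The common form of the Laplacian (\<open>s = -1\<close>) and the signless Laplacian (\<open>s = 1\<close>).\<close>

definition signed_laplacian :: "real \<Rightarrow> ('a, 'b) pre_digraph \<Rightarrow> real mat" where
  "signed_laplacian s D = out_degree_matrix D + s \<cdot>\<^sub>m adjacency_matrix D"

definition signed_laplacian_entry :: "real \<Rightarrow> ('a, 'b) pre_digraph \<Rightarrow> 'a \<Rightarrow> 'a \<Rightarrow> real" where
  "signed_laplacian_entry s D u v =
    (if u = v then real (out_degree D u) else 0) + s * of_bool (u \<rightarrow>\<^bsub>D\<^esub> v)"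

lemma laplacian_matrix_conv: "laplacian_matrix D = signed_laplacian (-1) D"
  by (rule eq_matI)
    (auto simp: laplacian_matrix_def signed_laplacian_def adjacency_matrix_def out_degree_matrix_def)

lemma signless_laplacian_matrix_conv: "signless_laplacian_matrix D = signed_laplacian 1 D"
  by (rule eq_matI)
    (auto simp: signless_laplacian_matrix_def signed_laplacian_def adjacency_matrix_def
      out_degree_matrix_def)

lemma signed_laplacian_carrier:
  "signed_laplacian s D \<in> carrier_mat (card (verts D)) (card (verts D))"
  by (simp add: signed_laplacian_def adjacency_matrix_def out_degree_matrix_def)

lemma bij_betw_vertex_list:
  assumes "finite (verts D)"
  shows "bij_betw ((!) (vertex_list D)) {0..<card (verts D)} (verts D)"
  unfolding atLeast0LessThan
  by (rule bij_betw_nth) (simp_all only: vertex_list[OF assms])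

lemma signed_laplacian_index:
  assumes "finite (verts D)" "i < card (verts D)" "j < card (verts D)"
  shows "signed_laplacian s D $$ (i, j)
    = signed_laplacian_entry s D (vertex_list D ! i) (vertex_list D ! j)"
proof -
  have "vertex_list D ! i = vertex_list D ! j \<longleftrightarrow> i = j"
    using bij_betw_imp_inj_on[OF bij_betw_vertex_list[OF assms(1)]] assms(2,3)
    by (simp add: inj_on_eq_iff)
  thus ?thesis using assms(2,3)
    by (simp add: signed_laplacian_def adjacency_matrix_def out_degree_matrix_def
        signed_laplacian_entry_def)
qed

lemma ratfun_subst_charpoly_signed_laplacian:
  assumes fin: "finite (verts D)"
  shows "ratfun_subst (to_fract (charpoly_complex (signed_laplacian s D))) g =
    det_on (verts D) (\<lambda>u v. (if u = v then g else 0) - real_const (signed_laplacian_entry s D u v))"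
proof -
  let ?n = "card (verts D)" and ?f = "(!) (vertex_list D)"
  note bij = bij_betw_vertex_list[OF fin]
  have inj: "?f i = ?f j \<longleftrightarrow> i = j" if "i < ?n" "j < ?n" for i j
    using bij_betw_imp_inj_on[OF bij] that by (simp add: inj_on_eq_iff)
  have "det_on (verts D) (\<lambda>u v. (if u = v then g else 0) - real_const (signed_laplacian_entry s D u v))
      = det_on {0..<?n} (\<lambda>i j. (if ?f i = ?f j then g else 0)
          - real_const (signed_laplacian_entry s D (?f i) (?f j)))"
    by (rule det_on_reindex[OF _ bij, symmetric]) simp
  also have "\<dots> = det_on {0..<?n} (\<lambda>i j. (if i = j then g else 0)
          - real_const (signed_laplacian s D $$ (i, j)))"
    by (rule det_on_cong) (simp_all add: signed_laplacian_index fin inj)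
  finally show ?thesis
    by (simp only: ratfun_subst_charpoly[OF signed_laplacian_carrier])
qed

lemma ratfun_subst_coronal_signed_laplacian:
  assumes fin: "finite (verts D)" and h: "degree h > 0"
  obtains u where
    "\<And>w. w \<in> verts D \<Longrightarrow> (\<Sum>w'\<in>verts D.
      ((if w = w' then to_fract h else 0) - real_const (signed_laplacian_entry s D w w')) * u w') = 1"
    "ratfun_subst (coronal (signed_laplacian s D)) (to_fract h) = (\<Sum>w\<in>verts D. u w)"
proof -
  let ?n = "card (verts D)" and ?f = "(!) (vertex_list D)"
  have bij: "bij_betw ?f {..<?n} (verts D)"
    using bij_betw_vertex_list[OF fin] by (simp add: atLeast0LessThan)
  obtain u where u:
    "\<And>i. i < ?n \<Longrightarrow> (\<Sum>j<?n. ((if i = j then to_fract h else 0)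
        - real_const (signed_laplacian s D $$ (i, j))) * u j) = 1"
    "ratfun_subst (coronal (signed_laplacian s D)) (to_fract h) = (\<Sum>j<?n. u j)"
    using ratfun_subst_coronal[OF signed_laplacian_carrier h] by blast
  \<comment> \<open>moves the solution from positions in the vertex list to vertices\<close>
  define u' where "u' w = u (the_inv_into {..<?n} ?f w)" for w
  have u': "u' (?f j) = u j" if "j < ?n" for j
    using bij_betw_imp_inj_on[OF bij] that by (simp add: u'_def the_inv_into_f_f)
  have inj: "?f i = ?f j \<longleftrightarrow> i = j" if "i < ?n" "j < ?n" for i j
    using bij_betw_imp_inj_on[OF bij] that by (simp add: inj_on_eq_iff)
  have sum: "(\<Sum>w\<in>verts D. g w) = (\<Sum>j<?n. g (?f j))" for g :: "'a \<Rightarrow> ratfun"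
    by (rule sum.reindex_bij_betw[OF bij, symmetric])
  show thesis
  proof (rule that[of u'])
    fix w assume "w \<in> verts D"
    then obtain i where i: "i < ?n" "w = ?f i" using bij by (auto simp: bij_betw_def)
    have "(\<Sum>w'\<in>verts D. ((if w = w' then to_fract h else 0)
          - real_const (signed_laplacian_entry s D w w')) * u' w')
      = (\<Sum>j<?n. ((if w = ?f j then to_fract h else 0)
          - real_const (signed_laplacian_entry s D w (?f j))) * u' (?f j))"
      by (rule sum)
    also have "\<dots> = (\<Sum>j<?n. ((if i = j then to_fract h else 0)
          - real_const (signed_laplacian s D $$ (i, j))) * u j)"
      by (rule sum.cong) (use i in \<open>simp_all add: u' signed_laplacian_index fin inj\<close>)
    also have "\<dots> = 1" by (rule u(1)[OF i(1)])
    finally show "(\<Sum>w'\<in>verts D. ((if w = w' then to_fract h else 0)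
          - real_const (signed_laplacian_entry s D w w')) * u' w') = 1" .
  next
    have "(\<Sum>w\<in>verts D. u' w) = (\<Sum>j<?n. u' (?f j))" by (rule sum)
    also have "\<dots> = (\<Sum>j<?n. u j)" by (rule sum.cong) (simp_all add: u')
    finally show "ratfun_subst (coronal (signed_laplacian s D)) (to_fract h) = (\<Sum>w\<in>verts D. u' w)"
      by (simp only: u(2))
  qed
qed

section \<open>Incidences and degrees\<close>

lemma (in digraph) card_arcs_between:
  "card {e \<in> arcs G. tail G e = u \<and> head G e = v} = of_bool (u \<rightarrow> v)"
proof (cases "u \<rightarrow> v")
  case True
  then obtain e where e: "e \<in> arcs G" "tail G e = u" "head G e = v"
    unfolding arcs_ends_conv by blast
  have "{e \<in> arcs G. tail G e = u \<and> head G e = v} = {e}"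
    using e no_multi_arcs[OF _ e(1)] by (auto simp only: arc_to_ends_def e)
  hence "card {e \<in> arcs G. tail G e = u \<and> head G e = v} = 1" by (metis card_1_singleton_iff One_nat_def)
  thus ?thesis using True by simp
next
  case False
  hence "{e \<in> arcs G. tail G e = u \<and> head G e = v} = {}"
    unfolding arcs_ends_conv by blast
  thus ?thesis using False by (simp only: card.empty of_bool_eq)
qed

text \<open>The product of the tail and the head incidence matrix is the adjacency matrix, because there is
  at most one arc between two vertices in each direction.\<close>

lemma (in digraph) sum_tail_head_incidence:
  "(\<Sum>e\<in>arcs G. of_bool (tail G e = u) * of_bool (head G e = v)) = (of_bool (u \<rightarrow> v) :: 'k :: comm_ring_1)"
proof -
  have "(\<Sum>e\<in>arcs G. of_bool (tail G e = u) * of_bool (head G e = v))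
      = (\<Sum>e\<in>arcs G. if tail G e = u \<and> head G e = v then 1 else 0 :: 'k)"
    by (rule sum.cong) auto
  also have "\<dots> = of_nat (card {e \<in> arcs G. tail G e = u \<and> head G e = v})"
    by (subst sum.inter_filter[symmetric]) simp_all
  finally show ?thesis by (simp only: card_arcs_between of_nat_of_bool)
qed

lemma (in digraph) sum_adjacency_row:
  "(\<Sum>v\<in>verts G. of_bool (u \<rightarrow> v)) = (of_nat (out_degree G u) :: 'k :: comm_ring_1)"
proof -
  have "(\<Sum>v\<in>verts G. of_bool (u \<rightarrow> v) :: 'k)
      = (\<Sum>v\<in>verts G. \<Sum>e\<in>arcs G. of_bool (tail G e = u) * of_bool (head G e = v))"
    by (simp only: sum_tail_head_incidence)
  also have "\<dots> = (\<Sum>e\<in>arcs G. \<Sum>v\<in>verts G. of_bool (tail G e = u) * of_bool (head G e = v))"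
    by (rule sum.swap)
  also have "\<dots> = (\<Sum>e\<in>arcs G. if tail G e = u then 1 else 0)"
  proof (rule sum.cong[OF refl])
    fix e assume e: "e \<in> arcs G"
    have "(\<Sum>v\<in>verts G. of_bool (tail G e = u) * of_bool (head G e = v) :: 'k)
        = (\<Sum>v\<in>verts G. if head G e = v then of_bool (tail G e = u) else 0)"
      by (rule sum.cong) auto
    also have "\<dots> = of_bool (tail G e = u)" using e by (subst sum.delta') auto
    finally show "(\<Sum>v\<in>verts G. of_bool (tail G e = u) * of_bool (head G e = v) :: 'k)
        = (if tail G e = u then 1 else 0)" by simp
  qed
  also have "\<dots> = of_nat (out_degree G u)"
    by (subst sum.inter_filter[symmetric]) (simp_all add: out_degree_def out_arcs_def)
  finally show ?thesis .
qed

lemma (in digraph) card_arcs_eq_sum_out_degree: "card (arcs G) = (\<Sum>v\<in>verts G. out_degree G v)"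
proof -
  have "arcs G = (\<Union>v\<in>verts G. out_arcs G v)" by auto
  moreover have "card (\<Union>v\<in>verts G. out_arcs G v) = (\<Sum>v\<in>verts G. card (out_arcs G v))"
    by (rule card_UN_disjoint) auto
  ultimately show ?thesis by (simp add: out_degree_def)
qed

lemma verts_join: "verts (D1 \<or>\<^sub>S D2) = Inl ` (Inl ` verts D1 \<union> Inr ` arcs D1) \<union> Inr ` verts D2"
  by (simp add: subdivision_vertex_join_def subdivision_digraph_def)

lemma dominates_join:
  "Inl (Inl v) \<rightarrow>\<^bsub>D1 \<or>\<^sub>S D2\<^esub> Inl (Inl v') \<longleftrightarrow> False"
  "Inl (Inl v) \<rightarrow>\<^bsub>D1 \<or>\<^sub>S D2\<^esub> Inl (Inr e) \<longleftrightarrow> e \<in> arcs D1 \<and> tail D1 e = v"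
  "Inl (Inl v) \<rightarrow>\<^bsub>D1 \<or>\<^sub>S D2\<^esub> Inr w \<longleftrightarrow> v \<in> verts D1 \<and> w \<in> verts D2"
  "Inl (Inr e) \<rightarrow>\<^bsub>D1 \<or>\<^sub>S D2\<^esub> Inl (Inl v) \<longleftrightarrow> e \<in> arcs D1 \<and> head D1 e = v"
  "Inl (Inr e) \<rightarrow>\<^bsub>D1 \<or>\<^sub>S D2\<^esub> Inl (Inr e') \<longleftrightarrow> False"
  "Inl (Inr e) \<rightarrow>\<^bsub>D1 \<or>\<^sub>S D2\<^esub> Inr w \<longleftrightarrow> False"
  "Inr w \<rightarrow>\<^bsub>D1 \<or>\<^sub>S D2\<^esub> Inl (Inl v) \<longleftrightarrow> v \<in> verts D1 \<and> w \<in> verts D2"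
  "Inr w \<rightarrow>\<^bsub>D1 \<or>\<^sub>S D2\<^esub> Inl (Inr e) \<longleftrightarrow> False"
  "Inr w \<rightarrow>\<^bsub>D1 \<or>\<^sub>S D2\<^esub> Inr w' \<longleftrightarrow> w \<rightarrow>\<^bsub>D2\<^esub> w'"
  by (auto simp: subdivision_vertex_join_def subdivision_digraph_def arcs_ends_conv)

lemma out_degree_join:
  fixes D1 :: "('a, 'b) pre_digraph" and D2 :: "('c, 'd) pre_digraph"
  assumes "nonempty_digraph D1" "nonempty_digraph D2"
  shows "v \<in> verts D1 \<Longrightarrow> out_degree (D1 \<or>\<^sub>S D2) (Inl (Inl v)) = out_degree D1 v + card (verts D2)"
    and "e \<in> arcs D1 \<Longrightarrow> out_degree (D1 \<or>\<^sub>S D2) (Inl (Inr e)) = 1"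
    and "w \<in> verts D2 \<Longrightarrow> out_degree (D1 \<or>\<^sub>S D2) (Inr w) = out_degree D2 w + card (verts D1)"
proof -
  interpret D1: digraph D1 using assms by (simp add: nonempty_digraph_def)
  interpret D2: digraph D2 using assms by (simp add: nonempty_digraph_def)
  interpret J: digraph "D1 \<or>\<^sub>S D2"
    using nonempty_digraph_join[OF assms] by (simp add: nonempty_digraph_def)
  have fin: "finite (verts D1)" "finite (arcs D1)" "finite (verts D2)" by auto
  have deg: "int (out_degree (D1 \<or>\<^sub>S D2) z) =
      (\<Sum>v\<in>verts D1. of_bool (z \<rightarrow>\<^bsub>D1 \<or>\<^sub>S D2\<^esub> Inl (Inl v)))
      + (\<Sum>e\<in>arcs D1. of_bool (z \<rightarrow>\<^bsub>D1 \<or>\<^sub>S D2\<^esub> Inl (Inr e)))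
      + (\<Sum>w\<in>verts D2. of_bool (z \<rightarrow>\<^bsub>D1 \<or>\<^sub>S D2\<^esub> Inr w))" for z
  proof -
    have sum: "(\<Sum>y\<in>verts (D1 \<or>\<^sub>S D2). f y) = (\<Sum>v\<in>verts D1. f (Inl (Inl v)))
        + (\<Sum>e\<in>arcs D1. f (Inl (Inr e))) + (\<Sum>w\<in>verts D2. f (Inr w))"
      for f :: "('a + 'b) + 'c \<Rightarrow> int"
      unfolding verts_join image_Un using fin
      by (subst sum.union_disjoint, simp, simp, blast, subst sum.union_disjoint, simp, simp, blast)
        (simp add: sum.reindex)
    show ?thesis
      using J.sum_adjacency_row[of z, where 'k = int]
        sum[of "\<lambda>y. of_bool (z \<rightarrow>\<^bsub>D1 \<or>\<^sub>S D2\<^esub> y)"]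
      by (simp only:)
  qed
  show "out_degree (D1 \<or>\<^sub>S D2) (Inl (Inl v)) = out_degree D1 v + card (verts D2)" if "v \<in> verts D1"
  proof -
    have "int (out_degree D1 v) = (\<Sum>e\<in>arcs D1. if tail D1 e = v then 1 else 0)"
      unfolding out_degree_def out_arcs_def
      by (subst sum.inter_filter[symmetric]) simp_all
    also have "\<dots> = (\<Sum>e\<in>arcs D1. of_bool (e \<in> arcs D1 \<and> tail D1 e = v))"
      by (rule sum.cong) auto
    finally have "(\<Sum>e\<in>arcs D1. of_bool (e \<in> arcs D1 \<and> tail D1 e = v)) = int (out_degree D1 v)" ..
    thus ?thesis using deg[of "Inl (Inl v)"] that by (simp add: dominates_join)
  qed
  show "out_degree (D1 \<or>\<^sub>S D2) (Inl (Inr e)) = 1" if e: "e \<in> arcs D1"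
  proof -
    have "(\<Sum>v\<in>verts D1. of_bool (head D1 e = v)) = (1 :: int)"
      using e fin by (simp add: of_bool_def)
    thus ?thesis using deg[of "Inl (Inr e)"] e by (simp add: dominates_join)
  qed
  show "out_degree (D1 \<or>\<^sub>S D2) (Inr w) = out_degree D2 w + card (verts D1)" if "w \<in> verts D2"
    using deg[of "Inr w"] that D2.sum_adjacency_row[of w, where 'k = int]
    by (simp add: dominates_join)
qed

section \<open>Characteristic polynomials of the join\<close>

lemma real_const_signed_laplacian_entry:
  "real_const (signed_laplacian_entry s G u v) =
    (if u = v then of_nat (out_degree G u) else 0) + real_const s * of_bool (u \<rightarrow>\<^bsub>G\<^esub> v)"
  by (simp add: signed_laplacian_entry_def const_ratfun_hom flip: real_const_of_nat)

text \<open>The formulas for both matrices at once. The vector \<open>u\<close> represents the coronal at \<open>x - n1\<close> by the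
  system that it solves, which leaves open how its sum is evaluated. The point at which the
  polynomial of \<open>D1\<close> is evaluated arises because \<open>(r + s a y) I - (r I + s A) = s (a y I - A)\<close>.\<close>

lemma charpoly_join:
  fixes D1 :: "('a, 'b) pre_digraph" and D2 :: "('c, 'd) pre_digraph" and s :: real
  defines "x \<equiv> indet" and "f \<equiv> \<lambda>M. to_fract (charpoly_complex M)"
  assumes D: "nonempty_digraph D1" "nonempty_digraph D2"
    and n: "n1 = card (verts D1)" "n2 = card (verts D2)"
    and reg: "out_regular r D1" and s: "s * s = 1"
    and u: "\<And>w. w \<in> verts D2 \<Longrightarrow> (\<Sum>w'\<in>verts D2.
      ((if w = w' then x - of_nat n1 else 0) - real_const (signed_laplacian_entry s D2 w w')) * u w') = 1"
  shows "f (signed_laplacian s (D1 \<or>\<^sub>S D2)) =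
    real_const s ^ n1 * (x - 1) powi (int n1 * (int r - 1))
    * ratfun_subst (f (signed_laplacian s D2)) (x - of_nat n1)
    * ratfun_subst (f (signed_laplacian s D1))
        (of_nat r + real_const s * ((x - of_nat r - of_nat n2) * (x - 1)))
    * (1 - (x - 1) * of_nat n1 * (\<Sum>w\<in>verts D2. u w)
        / ((x - of_nat r - of_nat n2) * (x - 1) - of_nat r))"
proof -
  interpret D1: digraph D1 using D by (simp add: nonempty_digraph_def)
  interpret D2: digraph D2 using D by (simp add: nonempty_digraph_def)
  interpret J: digraph "D1 \<or>\<^sub>S D2"
    using nonempty_digraph_join[OF D] by (simp add: nonempty_digraph_def)
  define S where "S = real_const s"
  define y where "y = x - 1"
  define a where "a = x - of_nat r - of_nat n2"
  define A :: "'a \<Rightarrow> 'a \<Rightarrow> ratfun" where "A v v' = of_bool (v \<rightarrow>\<^bsub>D1\<^esub> v')" for v v'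
  define N where "N w w' = (if w = w' then x - of_nat n1 else 0)
    - real_const (signed_laplacian_entry s D2 w w')" for w w'
  define F where "F z z' = (if z = z' then x else 0)
    - real_const (signed_laplacian_entry s (D1 \<or>\<^sub>S D2) z z')" for z z'
  have S: "S * S = 1"
    using s by (simp add: S_def flip: const_ratfun_hom of_real_mult)
  have r: "out_degree D1 v = r" if "v \<in> verts D1" for v
    using reg that by (simp add: out_regular_def)
  have y: "y = to_fract [:-1, 1:]"
    using indet_minus_of_nat[of 1] by (simp add: y_def x_def)
  have y0: "y \<noteq> 0" by (simp add: y)
  have nz: "a * y - of_nat r \<noteq> 0"
  proof -
    have a: "a = to_fract [:- of_nat (r + n2), 1:]"
      unfolding indet_minus_of_nat[symmetric] by (simp add: a_def x_def)
    have r: "(of_nat r :: ratfun) = to_fract [:of_nat r:]"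
      using real_const_of_nat[of r] by (simp add: const_ratfun_def)
    have "a * y - of_nat r = to_fract ([:- of_nat (r + n2), 1:] * [:-1, 1:] - [:of_nat r:])"
      unfolding a y r by (simp only: to_fract_mult to_fract_diff)
    \<comment> \<open>nonzero because it is monic of degree two\<close>
    moreover have "coeff ([:- of_nat (r + n2), 1:] * [:-1, 1:] - [:of_nat r:]) 2 = (1 :: complex)"
      by (simp add: numeral_2_eq_2)
    ultimately show ?thesis by (metis coeff_0 to_fract_eq_0_iff zero_neq_one)
  qed
  note entry = real_const_signed_laplacian_entry[where s = s, folded S_def]
  note simps = F_def entry dominates_join out_degree_join[OF D]
  have "y ^ n1 * det_on (verts (D1 \<or>\<^sub>S D2)) F = y ^ card (arcs D1)
      * det_on (verts D1) (\<lambda>v v'. (if v = v' then a * y else 0) - A v v') * det_on (verts D2) N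
      * (1 - y * of_nat n1 / (a * y - of_nat r) * (\<Sum>w\<in>verts D2. u w))"
    unfolding verts_join n(1)
  proof (rule det_on_subdivision_vertex_join[where s = "- S"
        and B = "\<lambda>v e. of_bool (tail D1 e = v)" and C = "\<lambda>e v. of_bool (head D1 e = v)"])
    show "(\<Sum>w'\<in>verts D2. N w w' * u w') = 1" if "w \<in> verts D2" for w
      using u[OF that] by (simp add: N_def)
    show "(\<Sum>v'\<in>verts D1. A v v') = of_nat r" if "v \<in> verts D1" for v
      unfolding A_def D1.sum_adjacency_row using r[OF that] by simp
    show "(\<Sum>e\<in>arcs D1. of_bool (tail D1 e = v) * of_bool (head D1 e = v')) = A v v'" for v v'
      unfolding A_def by (rule D1.sum_tail_head_incidence)
    show "F (Inr w) (Inr w') = N w w'" if "w \<in> verts D2" "w' \<in> verts D2" for w w'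
      using that by (simp add: simps N_def n)
  qed (use S y0 nz in \<open>simp_all add: simps r a_def y_def n\<close>)
  also have "card (arcs D1) = n1 * r"
    by (simp add: D1.card_arcs_eq_sum_out_degree r n)
  also have "det_on (verts D1) (\<lambda>v v'. (if v = v' then a * y else 0) - A v v')
      = S ^ n1 * ratfun_subst (f (signed_laplacian s D1)) (of_nat r + S * (a * y))"
  proof -
    have "ratfun_subst (f (signed_laplacian s D1)) (of_nat r + S * (a * y))
        = det_on (verts D1) (\<lambda>v v'. S * ((if v = v' then a * y else 0) - A v v'))"
      unfolding f_def ratfun_subst_charpoly_signed_laplacian[OF D1.finite_verts]
      by (rule det_on_cong) (auto simp: entry r A_def algebra_simps)
    also have "\<dots> = S ^ n1 * det_on (verts D1) (\<lambda>v v'. (if v = v' then a * y else 0) - A v v')"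
      unfolding n(1) by (rule det_on_smult)
    finally show ?thesis using S by (simp flip: mult.assoc power_mult_distrib)
  qed
  also have "det_on (verts D2) N = ratfun_subst (f (signed_laplacian s D2)) (x - of_nat n1)"
    unfolding f_def N_def by (rule ratfun_subst_charpoly_signed_laplacian[symmetric]) simp
  also have "det_on (verts (D1 \<or>\<^sub>S D2)) F = f (signed_laplacian s (D1 \<or>\<^sub>S D2))"
    unfolding f_def F_def x_def
    using ratfun_subst_charpoly_signed_laplacian[of "D1 \<or>\<^sub>S D2" s indet]
    by (simp add: ratfun_subst_indet)
  also have "y * of_nat n1 / (a * y - of_nat r) * (\<Sum>w\<in>verts D2. u w)
      = y * of_nat n1 * (\<Sum>w\<in>verts D2. u w) / (a * y - of_nat r)" by simp
  finally have main: "y ^ n1 * f (signed_laplacian s (D1 \<or>\<^sub>S D2)) = y ^ (n1 * r) *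
      (S ^ n1 * ratfun_subst (f (signed_laplacian s D1)) (of_nat r + S * (a * y))) *
      ratfun_subst (f (signed_laplacian s D2)) (x - of_nat n1)
      * (1 - y * of_nat n1 * (\<Sum>w\<in>verts D2. u w) / (a * y - of_nat r))"
    (is "_ = _ * (_ * ?f1) * ?f2 * ?q") .
  \<comment> \<open>the integer exponent allows for \<open>r = 0\<close>, where a power of \<open>y\<close> remains in the denominator\<close>
  have "y powi (int n1 * (int r - 1)) = y ^ (n1 * r) / y ^ n1"
    using y0 by (simp add: right_diff_distrib power_int_diff flip: of_nat_mult)
  hence "S ^ n1 * y powi (int n1 * (int r - 1)) * ?f2 * ?f1 * ?q
      = (y ^ (n1 * r) * (S ^ n1 * ?f1) * ?f2 * ?q) / y ^ n1"
    by (simp only: times_divide_eq_left times_divide_eq_right mult_ac)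
  also have "\<dots> = f (signed_laplacian s (D1 \<or>\<^sub>S D2))"
    unfolding main[symmetric] using y0 by simp
  finally show ?thesis
    unfolding y_def[symmetric] a_def[symmetric] S_def[symmetric] by (rule sym)
qed

section \<open>Spectra determine the data in the formulas\<close>

text \<open>Induction via the derivative of the characteristic polynomial, which is the sum of those of the
  principal submatrices with one row and column removed: each diagonal entry survives in all but
  one of these.\<close>

lemma coeff_char_poly_trace:
  fixes A :: "'k :: {idom, ring_char_0} mat"
  assumes "A \<in> carrier_mat (Suc n) (Suc n)"
  shows "coeff (char_poly A) n = - (\<Sum>i<Suc n. A $$ (i, i))"
  using assms
proof (induction n arbitrary: A)
  case 0
  have "char_poly A = [:- (A $$ (0, 0)), 1:]"
    using 0 by (auto simp: char_poly_def char_poly_matrix_def det_single)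
  thus ?case by simp
next
  case (Suc n)
  define t where "t = (\<Sum>i<Suc (Suc n). A $$ (i, i))"
  have del: "(\<Sum>j<Suc n. mat_delete A i i $$ (j, j)) = t - A $$ (i, i)" if i: "i < Suc (Suc n)" for i
  proof -
    have b: "bij_betw (\<lambda>j. if j < i then j else Suc j) {..<Suc n} ({..<Suc (Suc n)} - {i})"
      by (rule bij_betw_byWitness[of _ "\<lambda>j. if j < i then j else j - 1"]) (use i in auto)
    have "(\<Sum>j<Suc n. mat_delete A i i $$ (j, j))
        = (\<Sum>j<Suc n. (\<lambda>j. A $$ (j, j)) (if j < i then j else Suc j))"
      using Suc.prems by (intro sum.cong) (auto simp: mat_delete_def)
    also have "\<dots> = (\<Sum>j\<in>{..<Suc (Suc n)} - {i}. A $$ (j, j))"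
      by (rule sum.reindex_bij_betw[OF b])
    also have "\<dots> = t - A $$ (i, i)"
      using i unfolding t_def by (subst sum_diff1) auto
    finally show ?thesis .
  qed
  have "of_nat (Suc n) * coeff (char_poly A) (Suc n) = coeff (pderiv (char_poly A)) n"
    by (simp add: coeff_pderiv)
  also have "\<dots> = (\<Sum>i<Suc (Suc n). coeff (char_poly (mat_delete A i i)) n)"
    unfolding pderiv_char_poly[OF Suc.prems] by (rule coeff_sum)
  also have "\<dots> = (\<Sum>i<Suc (Suc n). - (t - A $$ (i, i)))"
  proof (rule sum.cong[OF refl])
    fix i assume "i \<in> {..<Suc (Suc n)}"
    hence i: "i < Suc (Suc n)" by simp
    have "mat_delete A i i \<in> carrier_mat (Suc n) (Suc n)"
      using mat_delete_carrier[OF Suc.prems] by simp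
    from Suc.IH[OF this] show "coeff (char_poly (mat_delete A i i)) n = - (t - A $$ (i, i))"
      by (simp only: del[OF i])
  qed
  also have "\<dots> = t - of_nat (Suc (Suc n)) * t"
    unfolding minus_diff_eq sum_subtractf by (simp only: sum_constant card_lessThan t_def)
  also have "\<dots> = of_nat (Suc n) * (- t)"
    by (simp add: algebra_simps)
  finally show ?case
    unfolding t_def by (simp only: mult_cancel_left of_nat_eq_0_iff) simp
qed

lemma charpoly_complex_degree_monic:
  assumes "M \<in> carrier_mat n n"
  shows "degree (charpoly_complex M) = n" "lead_coeff (charpoly_complex M) = 1"
  using degree_monic_char_poly[of "map_mat complex_of_real M" n] assms
  by (auto simp: charpoly_complex_def)

text \<open>Monic complex polynomials are determined by their roots.\<close>

lemma charpoly_complex_eqI: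
  assumes "M \<in> carrier_mat m m" "N \<in> carrier_mat n n"
    and "proots (charpoly_complex M) = proots (charpoly_complex N)"
  shows "charpoly_complex M = charpoly_complex N"
  using complex_poly_decompose_multiset[of "charpoly_complex M"]
    complex_poly_decompose_multiset[of "charpoly_complex N"] assms
  by (simp add: charpoly_complex_degree_monic(2))

text \<open>Without loops the adjacency matrix has zero diagonal, so the trace of \<open>D\<^sub>o\<^sub>u\<^sub>t + s A\<close> is the number
  of vertices times the out-degree.\<close>

lemma regular_data_of_charpoly:
  assumes D: "nonempty_digraph D" "nonempty_digraph D'"
    and reg: "out_regular r D" "out_regular r' D'"
    and eq: "charpoly_complex (signed_laplacian s D) = charpoly_complex (signed_laplacian s D')"
  shows "card (verts D) = card (verts D')" "r = r'"
proof -
  show card: "card (verts D) = card (verts D')"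
    using charpoly_complex_degree_monic(1)[OF signed_laplacian_carrier] eq by metis
  have tr: "coeff (charpoly_complex (signed_laplacian s G)) (card (verts G) - 1)
      = - of_nat (card (verts G) * q)"
    if G: "nonempty_digraph G" and q: "out_regular q G" for G :: "('x, 'y) pre_digraph" and q
  proof -
    interpret digraph G using G by (simp add: nonempty_digraph_def)
    let ?n = "card (verts G)" and ?A = "map_mat complex_of_real (signed_laplacian s G)"
    have "?n > 0" using G by (simp add: nonempty_digraph_def card_gt_0_iff)
    then obtain k where k: "?n = Suc k" using gr0_conv_Suc by blast
    have A: "?A \<in> carrier_mat (Suc k) (Suc k)"
      using signed_laplacian_carrier[of s G] by (simp add: k)
    have "?A $$ (i, i) = of_nat q" if "i < Suc k" for i
    proof -
      have v: "vertex_list G ! i \<in> verts G"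
        using bij_betwE[OF bij_betw_vertex_list[OF finite_verts]] that k by simp
      have "\<not> vertex_list G ! i \<rightarrow>\<^bsub>G\<^esub> vertex_list G ! i"
        using no_loops by (fastforce simp: arcs_ends_conv)
      thus ?thesis using that A q v k
        by (simp add: signed_laplacian_index signed_laplacian_entry_def out_regular_def)
    qed
    hence "(\<Sum>i<Suc k. ?A $$ (i, i)) = of_nat (Suc k * q)" by (simp add: algebra_simps)
    thus ?thesis unfolding charpoly_complex_def k using coeff_char_poly_trace[OF A] by simp
  qed
  have "card (verts D) * r = card (verts D') * r'"
    using tr[OF D(1) reg(1)] tr[OF D(2) reg(2)] eq card
    by (metis neg_equal_iff_equal of_nat_eq_iff)
  thus "r = r'" using D by (simp add: card nonempty_digraph_def card_eq_0_iff digraph_def fin_digraph.finite_verts)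
qed

section \<open>Laplacian and signless Laplacian of the join\<close>

text \<open>The rows of a Laplacian sum to zero, so the constant vector \<open>1 / (x - n1)\<close> solves the system for
  the coronal.\<close>

lemma L_charpoly_join:
  fixes D1 :: "('a, 'b) pre_digraph" and D2 :: "('c, 'd) pre_digraph"
  defines "x \<equiv> indet"
  assumes D: "nonempty_digraph D1" "nonempty_digraph D2"
    and n: "n1 = card (verts D1)" "n2 = card (verts D2)" and reg: "out_regular r D1"
  shows "L_charpoly (D1 \<or>\<^sub>S D2) =
    (-1) ^ n1 * (x - 1) powi (int n1 * (int r - 1))
    * ratfun_subst (L_charpoly D2) (x - of_nat n1)
    * ratfun_subst (L_charpoly D1) (of_nat r - (x - of_nat r - of_nat n2) * (x - 1))
    * (1 - (x - 1) * of_nat n1 * of_nat n2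
        / ((x - of_nat n1) * ((x - of_nat n2 - of_nat r) * (x - 1) - of_nat r)))"
proof -
  interpret D2: digraph D2 using D by (simp add: nonempty_digraph_def)
  have c: "real_const (-1) = -1"
    by (simp add: const_ratfun_uminus const_ratfun_hom)
  have nz: "x - of_nat n1 \<noteq> 0" by (simp add: x_def indet_minus_of_nat)
  have row: "(\<Sum>w'\<in>verts D2. ((if w = w' then x - of_nat n1 else 0)
      - real_const (signed_laplacian_entry (-1) D2 w w')) * (1 / (x - of_nat n1))) = 1"
    if w: "w \<in> verts D2" for w
  proof -
    have "(\<Sum>w'\<in>verts D2. (if w = w' then x - of_nat n1 else 0)
        - real_const (signed_laplacian_entry (-1) D2 w w'))
      = (\<Sum>w'\<in>verts D2. if w = w' then x - of_nat n1 else 0)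
        - ((\<Sum>w'\<in>verts D2. if w = w' then of_nat (out_degree D2 w) else 0)
          - (\<Sum>w'\<in>verts D2. of_bool (w \<rightarrow>\<^bsub>D2\<^esub> w')))"
      unfolding real_const_signed_laplacian_entry c sum_subtractf sum.distrib
      by (simp only: sum_negf mult_minus1 add_uminus_conv_diff)
    also have "\<dots> = x - of_nat n1"
      unfolding D2.sum_adjacency_row using w by simp
    finally show ?thesis using nz by (simp only: sum_distrib_right[symmetric]) simp
  qed
  have "L_charpoly (D1 \<or>\<^sub>S D2) = (-1) ^ n1 * (x - 1) powi (int n1 * (int r - 1))
      * ratfun_subst (L_charpoly D2) (x - of_nat n1)
      * ratfun_subst (L_charpoly D1) (of_nat r + (-1) * ((x - of_nat r - of_nat n2) * (x - 1)))
      * (1 - (x - 1) * of_nat n1 * (\<Sum>w\<in>verts D2. 1 / (x - of_nat n1))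
        / ((x - of_nat r - of_nat n2) * (x - 1) - of_nat r))"
    unfolding L_charpoly_def laplacian_matrix_conv x_def
    by (rule charpoly_join[OF D n reg, where s = "-1", unfolded c, OF _ row[unfolded x_def]]) simp
  also have "(\<Sum>w\<in>verts D2. 1 / (x - of_nat n1)) = of_nat n2 / (x - of_nat n1)"
    by (simp add: n)
  finally have J: "L_charpoly (D1 \<or>\<^sub>S D2) = (-1) ^ n1 * (x - 1) powi (int n1 * (int r - 1))
      * ratfun_subst (L_charpoly D2) (x - of_nat n1)
      * ratfun_subst (L_charpoly D1) (of_nat r + (-1) * ((x - of_nat r - of_nat n2) * (x - 1)))
      * (1 - (x - 1) * of_nat n1 * (of_nat n2 / (x - of_nat n1))
        / ((x - of_nat r - of_nat n2) * (x - 1) - of_nat r))" .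
  have comm: "x - of_nat n2 - of_nat r = x - of_nat r - of_nat n2" by simp
  show ?thesis unfolding J comm by simp
qed

lemma Q_charpoly_join:
  fixes D1 :: "('a, 'b) pre_digraph" and D2 :: "('c, 'd) pre_digraph"
  defines "x \<equiv> indet"
  assumes D: "nonempty_digraph D1" "nonempty_digraph D2"
    and n: "n1 = card (verts D1)" "n2 = card (verts D2)" and reg: "out_regular r D1"
  shows "Q_charpoly (D1 \<or>\<^sub>S D2) =
    (x - 1) powi (int n1 * (int r - 1))
    * ratfun_subst (Q_charpoly D2) (x - of_nat n1)
    * ratfun_subst (Q_charpoly D1) (of_nat r + (x - of_nat r - of_nat n2) * (x - 1))
    * (1 - (x - 1) * of_nat n1 * ratfun_subst (Q_coronal D2) (x - of_nat n1)
        / ((x - of_nat r - of_nat n2) * (x - 1) - of_nat r))"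
proof -
  interpret D2: digraph D2 using D by (simp add: nonempty_digraph_def)
  have c: "real_const 1 = 1" by (simp add: const_ratfun_hom)
  have h: "x - of_nat n1 = to_fract [:- of_nat n1, 1:]"
    unfolding x_def by (rule indet_minus_of_nat)
  obtain u where u:
    "\<And>w. w \<in> verts D2 \<Longrightarrow> (\<Sum>w'\<in>verts D2. ((if w = w' then x - of_nat n1 else 0)
      - real_const (signed_laplacian_entry 1 D2 w w')) * u w') = 1"
    "ratfun_subst (Q_coronal D2) (x - of_nat n1) = (\<Sum>w\<in>verts D2. u w)"
    unfolding Q_coronal_def signless_laplacian_matrix_conv h
    by (rule ratfun_subst_coronal_signed_laplacian[OF D2.finite_verts, of "[:- of_nat n1, 1:]" 1]) auto
  have "Q_charpoly (D1 \<or>\<^sub>S D2) = 1 ^ n1 * (x - 1) powi (int n1 * (int r - 1))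
      * ratfun_subst (Q_charpoly D2) (x - of_nat n1)
      * ratfun_subst (Q_charpoly D1) (of_nat r + 1 * ((x - of_nat r - of_nat n2) * (x - 1)))
      * (1 - (x - 1) * of_nat n1 * (\<Sum>w\<in>verts D2. u w)
        / ((x - of_nat r - of_nat n2) * (x - 1) - of_nat r))"
    unfolding Q_charpoly_def signless_laplacian_matrix_conv x_def
    by (rule charpoly_join[OF D n reg, where s = 1, unfolded c, OF _ u(1)[unfolded x_def]]) simp
  thus ?thesis by (simp only: u(2) power_one mult_1)
qed

lemma L_spectrum_join_determined:
  assumes D: "nonempty_digraph D1" "nonempty_digraph D2" "out_regular r D1"
    and D': "nonempty_digraph D1'" "nonempty_digraph D2'" "out_regular r' D1'"
    and spec: "L_spectrum D1 = L_spectrum D1'" "L_spectrum D2 = L_spectrum D2'"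
  shows "L_spectrum (D1 \<or>\<^sub>S D2) = L_spectrum (D1' \<or>\<^sub>S D2')"
proof -
  have 1: "charpoly_complex (signed_laplacian (-1) D1) = charpoly_complex (signed_laplacian (-1) D1')"
    and 2: "charpoly_complex (signed_laplacian (-1) D2) = charpoly_complex (signed_laplacian (-1) D2')"
    using spec unfolding L_spectrum_def laplacian_matrix_conv
    by (auto intro: charpoly_complex_eqI signed_laplacian_carrier)
  have data: "card (verts D1) = card (verts D1')" "r = r'" "card (verts D2) = card (verts D2')"
    using regular_data_of_charpoly[OF D(1) D'(1) D(3) D'(3) 1]
      charpoly_complex_degree_monic(1)[OF signed_laplacian_carrier, of "-1" D2]
      charpoly_complex_degree_monic(1)[OF signed_laplacian_carrier, of "-1" D2'] 2 by auto
  have "L_charpoly D1 = L_charpoly D1'" "L_charpoly D2 = L_charpoly D2'"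
    using 1 2 by (simp_all add: L_charpoly_def laplacian_matrix_conv)
  hence "L_charpoly (D1 \<or>\<^sub>S D2) = L_charpoly (D1' \<or>\<^sub>S D2')"
    unfolding L_charpoly_join[OF D(1,2) refl refl D(3)]
      L_charpoly_join[OF D'(1,2) refl refl D'(3)] data by simp
  thus ?thesis by (simp add: L_charpoly_def L_spectrum_def)
qed

lemma Q_spectrum_join_determined:
  assumes D: "nonempty_digraph D1" "nonempty_digraph D2" "out_regular r D1"
    and D': "nonempty_digraph D1'" "nonempty_digraph D2'" "out_regular r' D1'"
    and spec: "Q_spectrum D1 = Q_spectrum D1'" "Q_spectrum D2 = Q_spectrum D2'"
    and cor: "Q_coronal D2 = Q_coronal D2'"
  shows "Q_spectrum (D1 \<or>\<^sub>S D2) = Q_spectrum (D1' \<or>\<^sub>S D2')"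
proof -
  have 1: "charpoly_complex (signed_laplacian 1 D1) = charpoly_complex (signed_laplacian 1 D1')"
    and 2: "charpoly_complex (signed_laplacian 1 D2) = charpoly_complex (signed_laplacian 1 D2')"
    using spec unfolding Q_spectrum_def signless_laplacian_matrix_conv
    by (auto intro: charpoly_complex_eqI signed_laplacian_carrier)
  have data: "card (verts D1) = card (verts D1')" "r = r'" "card (verts D2) = card (verts D2')"
    using regular_data_of_charpoly[OF D(1) D'(1) D(3) D'(3) 1]
      charpoly_complex_degree_monic(1)[OF signed_laplacian_carrier, of 1 D2]
      charpoly_complex_degree_monic(1)[OF signed_laplacian_carrier, of 1 D2'] 2 by auto
  have "Q_charpoly D1 = Q_charpoly D1'" "Q_charpoly D2 = Q_charpoly D2'"
    using 1 2 by (simp_all add: Q_charpoly_def signless_laplacian_matrix_conv)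
  hence "Q_charpoly (D1 \<or>\<^sub>S D2) = Q_charpoly (D1' \<or>\<^sub>S D2')"
    unfolding Q_charpoly_join[OF D(1,2) refl refl D(3)]
      Q_charpoly_join[OF D'(1,2) refl refl D'(3)] data cor by simp
  thus ?thesis by (simp add: Q_charpoly_def Q_spectrum_def)
qed

theorem theorem4p5:
  fixes D1 :: "('a, 'b) pre_digraph" and D2 :: "('c, 'd) pre_digraph"
    and n1 n2 m1 m2 r :: nat and x :: ratfun
  assumes "nonempty_digraph D1" and "nonempty_digraph D2"
    and "n1 = card (verts D1)" and "n2 = card (verts D2)"
    and "m1 = card (arcs D1)" and "m2 = card (arcs D2)"
    and "out_regular r D1"
    and "x = indet"
  shows
    "L_charpoly (D1 \<or>\<^sub>S D2) =
       (-1) ^ n1 * (x - 1) powi (int n1 * (int r - 1))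
       * ratfun_subst (L_charpoly D2) (x - of_nat n1)
       * ratfun_subst (L_charpoly D1) (of_nat r - (x - of_nat r - of_nat n2) * (x - 1))
       * (1 - (x - 1) * of_nat n1 * of_nat n2
              / ((x - of_nat n1) * ((x - of_nat n2 - of_nat r) * (x - 1) - of_nat r)))
     \<and>
     Q_charpoly (D1 \<or>\<^sub>S D2) =
       (x - 1) powi (int n1 * (int r - 1))
       * ratfun_subst (Q_charpoly D2) (x - of_nat n1)
       * ratfun_subst (Q_charpoly D1) (of_nat r + (x - of_nat r - of_nat n2) * (x - 1))
       * (1 - (x - 1) * of_nat n1 * ratfun_subst (Q_coronal D2) (x - of_nat n1)
              / ((x - of_nat r - of_nat n2) * (x - 1) - of_nat r))
     \<and>
     (\<forall>(D1' :: ('e, 'f) pre_digraph) (D2' :: ('g, 'h) pre_digraph) r'.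
        nonempty_digraph D1' \<longrightarrow> nonempty_digraph D2' \<longrightarrow> out_regular r' D1' \<longrightarrow>
        L_spectrum D1 = L_spectrum D1' \<longrightarrow> L_spectrum D2 = L_spectrum D2' \<longrightarrow>
        L_spectrum (D1 \<or>\<^sub>S D2) = L_spectrum (D1' \<or>\<^sub>S D2'))
     \<and>
     (\<forall>(D1' :: ('e, 'f) pre_digraph) (D2' :: ('g, 'h) pre_digraph) r'.
        nonempty_digraph D1' \<longrightarrow> nonempty_digraph D2' \<longrightarrow> out_regular r' D1' \<longrightarrow>
        Q_spectrum D1 = Q_spectrum D1' \<longrightarrow> Q_spectrum D2 = Q_spectrum D2' \<longrightarrow>
        Q_coronal D2 = Q_coronal D2' \<longrightarrow>
        Q_spectrum (D1 \<or>\<^sub>S D2) = Q_spectrum (D1' \<or>\<^sub>S D2'))"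
  using L_charpoly_join[OF assms(1-4) assms(7)] Q_charpoly_join[OF assms(1-4) assms(7)]
    L_spectrum_join_determined[OF assms(1,2,7)] Q_spectrum_join_determined[OF assms(1,2,7)]
  unfolding assms(8) by blast

end
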